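(* Let $n\ge 1$ be an integer, let $c>0$, and let $a_1,\dots,a_n:[0,c]\to\mathbb{R}$ be Lipschitz functions. Then there is a constant $b$ with $0<b\le c$, depending on the coefficients $\{a_i\}$ only, such that for every $C^n$ function $y:[0,c]\to\mathbb{R}$ satisfying the differential inequality $$y^{(n)}(x)+a_1(x)\,y^{(n-1)}(x)+\cdots+a_n(x)\,y(x)\ge 0\qquad\text{for all }x\in[0,c]$$ and the initial conditions $$y^{(i)}(0)=0\quad\text{for } i=0,1,\dots,n-1,$$ the following hold: (1) for every $i=0,\dots,n-1$, $y^{(i)}\ge 0$ on $[0,b]$; (2) $y=0$ on the whole interval $[0,b]$ if and only if the differential inequality holds with equality on the whole interval $[0,b]$.
   Context: Here $y^{(i)}$ denotes the $i$-th derivative of $y$, with $y^{(0)}=y$ and one-sided derivatives at the endpoints of $[0,c]$. The constant $b$ is independent of $y$. *)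

theory Defs
  imports "HOL-Analysis.Analysis"
begin

text \<open>
  Functions on an interval are total functions of type real to real; only their values on the
  interval matter.  On a nondegenerate closed interval \<open>S\<close> the filter \<open>at x within S\<close> gives the
  two-sided derivative at interior points and the one-sided derivative at the endpoints, and such
  derivatives are unique there.
\<close>

definition iter_deriv_on :: "real set \<Rightarrow> nat \<Rightarrow> (real \<Rightarrow> real) \<Rightarrow> real \<Rightarrow> real" where
  "iter_deriv_on S k y = ((\<lambda>f x. vector_derivative f (at x within S)) ^^ k) y"

definition Cn_on :: "nat \<Rightarrow> real set \<Rightarrow> (real \<Rightarrow> real) \<Rightarrow> bool" where
  "Cn_on n S y \<longleftrightarrow>
     (\<forall>k<n. iter_deriv_on S k y differentiable_on S) \<and> continuous_on S (iter_deriv_on S n y)"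

text \<open>The operator \<open>y\<^sup>(\<^sup>n\<^sup>) + a\<^sub>1 y\<^sup>(\<^sup>n\<^sup>-\<^sup>1\<^sup>) + \<dots> + a\<^sub>n y\<close>, with derivatives taken within \<open>S\<close>.\<close>

definition lin_diff_op ::
  "real set \<Rightarrow> nat \<Rightarrow> (nat \<Rightarrow> real \<Rightarrow> real) \<Rightarrow> (real \<Rightarrow> real) \<Rightarrow> real \<Rightarrow> real" where
  "lin_diff_op S n a y x =
     iter_deriv_on S n y x + (\<Sum>i=1..n. a i x * iter_deriv_on S (n - i) y x)"

end

theory Submission
  imports Defs
begin

text \<open>
  Write \<open>f \<ge> 0\<close> for the left-hand side of the inequality, \<open>u = y\<^sup>(\<^sup>n\<^sup>-\<^sup>1\<^sup>)\<close>, \<open>F x\<close> for the integral of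
  \<open>f\<close> over \<open>[0, x]\<close>, and let \<open>U\<close> be the maximum of \<open>|u|\<close> on \<open>[0, x]\<close>, where \<open>x \<le> 1\<close>. The initial
  conditions give \<open>|y\<^sup>(\<^sup>i\<^sup>)| \<le> U\<close> on \<open>[0, x]\<close> for all \<open>i < n\<close>, so with \<open>|a\<^sub>i| \<le> M\<close> we get
  \<open>|u - F| \<le> n M x U \<le> U / 2\<close> there as soon as \<open>n M x \<le> 1 / 2\<close>. Since \<open>F\<close> is nondecreasing,
  \<open>U \<le> F x + U / 2\<close>, so \<open>U \<le> 2 F x\<close> and \<open>u x \<ge> F x - U / 2 \<ge> 0\<close>; and \<open>u\<close> vanishes when \<open>F\<close>
  does. The lower derivatives follow by integration.
\<close>

text \<open>By the mean value theorem on \<open>{0..t}\<close>, \<open>g t = g' z * t\<close> for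
  some \<open>z\<close> inside; this requires \<open>0 < t\<close>, hence the case split.\<close>

lemma deriv_ge_imp_ge_linear:
  fixes g g' :: "real \<Rightarrow> real"
  assumes der: "\<And>t. t \<in> {0..x} \<Longrightarrow> (g has_real_derivative g' t) (at t within {0..x})"
    and "g 0 = 0" and ge: "\<And>t. t \<in> {0..x} \<Longrightarrow> m \<le> g' t" and t: "t \<in> {0..x}"
  shows "m * t \<le> g t"
proof (cases "t = 0")
  case False
  with t have "0 < t" by simp
  have "\<exists>z\<in>{0<..<t}. g t - g 0 = (\<lambda>h. g' z * h) (t - 0)"
  proof (rule mvt_simple[OF \<open>0 < t\<close>])
    fix z assume "0 \<le> z" "z \<le> t"
    then have "(g has_real_derivative g' z) (at z within {0..t})"
      using t by (intro DERIV_subset[OF der]) auto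
    then show "(g has_derivative (*) (g' z)) (at z within {0..t})"
      by (simp add: has_field_derivative_def)
  qed
  then obtain z where z: "0 < z" "z < t" "g t = g' z * t"
    using \<open>g 0 = 0\<close> by auto
  then show ?thesis
    using ge[of z] t by (auto intro: mult_right_mono)
qed (use assms in auto)

lemma abs_deriv_le_imp_abs_le_linear:
  fixes g g' :: "real \<Rightarrow> real"
  assumes der: "\<And>t. t \<in> {0..x} \<Longrightarrow> (g has_real_derivative g' t) (at t within {0..x})"
    and "g 0 = 0" and le: "\<And>t. t \<in> {0..x} \<Longrightarrow> \<bar>g' t\<bar> \<le> m" and t: "t \<in> {0..x}"
  shows "\<bar>g t\<bar> \<le> m * t"
proof -
  have "- m * t \<le> g t"
    by (rule deriv_ge_imp_ge_linear[OF der \<open>g 0 = 0\<close> _ t]) (use le in force)+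
  moreover have "- m * t \<le> - g t"
    by (rule deriv_ge_imp_ge_linear[of x "\<lambda>t. - g t" "\<lambda>t. - g' t"])
      (use assms in \<open>force intro!: DERIV_minus\<close>)+
  ultimately show ?thesis by simp
qed

text \<open>Isolates what the estimates use of the iterated derivatives of \<open>y\<close>, apart
  from how \<open>iter_deriv_on\<close> is defined.\<close>

locale derivative_chain =
  fixes D :: "nat \<Rightarrow> real \<Rightarrow> real" and n :: nat and c :: real
  assumes deriv: "\<And>k t. k < n \<Longrightarrow> t \<in> {0..c} \<Longrightarrow>
      (D k has_real_derivative D (Suc k) t) (at t within {0..c})"
    and init: "\<And>k. k < n \<Longrightarrow> D k 0 = 0"
begin

lemma deriv_subinterval:
  "k < n \<Longrightarrow> x \<le> c \<Longrightarrow> t \<in> {0..x} \<Longrightarrow>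
    (D k has_real_derivative D (Suc k) t) (at t within {0..x})"
  by (rule DERIV_subset[OF deriv]) auto

text \<open>Descending induction from \<open>n - 1\<close>: each integration from 0 multiplies the
  bound by \<open>t\<close>, which is at most 1.\<close>

lemma abs_le_of_last:
  assumes "x \<le> c" "x \<le> 1" and last: "\<And>t. t \<in> {0..x} \<Longrightarrow> \<bar>D (n - 1) t\<bar> \<le> U"
    and "k \<le> n - 1" "0 < n" "t \<in> {0..x}"
  shows "\<bar>D k t\<bar> \<le> U"
  using \<open>k \<le> n - 1\<close> \<open>t \<in> {0..x}\<close>
proof (induction arbitrary: t rule: inc_induct)
  case base
  then show ?case using last by blast
next
  case (step k)
  have "0 \<le> U" using last[OF step.prems] by linarith
  have "\<bar>D k t\<bar> \<le> U * t"
    using step \<open>x \<le> c\<close>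
    by (intro abs_deriv_le_imp_abs_le_linear[OF deriv_subinterval _ step.IH]) (auto intro: init)
  also have "\<dots> \<le> U * 1"
    using \<open>0 \<le> U\<close> step.prems \<open>x \<le> 1\<close> by (intro mult_left_mono) auto
  finally show ?case by simp
qed

lemma nonneg_of_last:
  assumes "x \<le> c" and last: "\<And>t. t \<in> {0..x} \<Longrightarrow> 0 \<le> D (n - 1) t"
    and "k \<le> n - 1" "0 < n" "t \<in> {0..x}"
  shows "0 \<le> D k t"
  using \<open>k \<le> n - 1\<close> \<open>t \<in> {0..x}\<close>
proof (induction arbitrary: t rule: inc_induct)
  case base
  then show ?case using last by blast
next
  case (step k)
  have "0 * t \<le> D k t"
    using step \<open>x \<le> c\<close>
    by (intro deriv_ge_imp_ge_linear[OF deriv_subinterval _ step.IH]) (auto intro: init)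
  then show ?case by simp
qed

text \<open>The estimates are stated for a single right endpoint \<open>x\<close>; later each point
  of \<open>{0..b}\<close> takes this role. The condition \<open>n * M * x \<le> 1 / 2\<close> is
  what makes the lower-order terms absorbable.\<close>

context
  fixes a :: "nat \<Rightarrow> real \<Rightarrow> real" and M :: real and f :: "real \<Rightarrow> real" and x :: real
  assumes a_bound: "\<And>i t. i \<in> {1..n} \<Longrightarrow> t \<in> {0..c} \<Longrightarrow> \<bar>a i t\<bar> \<le> M"
    and f_cont: "continuous_on {0..c} f"
    and f_eq: "\<And>t. t \<in> {0..c} \<Longrightarrow> f t = D n t + (\<Sum>i=1..n. a i t * D (n - i) t)"
    and f_nonneg: "\<And>t. t \<in> {0..c} \<Longrightarrow> 0 \<le> f t"
    and n_pos: "0 < n" and x_small: "0 \<le> x" "x \<le> c" "x \<le> 1" "n * M * x \<le> 1 / 2"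
begin

text \<open>The difference vanishes at 0, and in its derivative \<open>D n - f\<close> the top-order
  term cancels, leaving \<open>n\<close> products, each at most \<open>M * U\<close> in absolute
  value.\<close>

lemma abs_last_diff_integral_le:
  assumes U: "\<And>t. t \<in> {0..x} \<Longrightarrow> \<bar>D (n - 1) t\<bar> \<le> U" and t: "t \<in> {0..x}"
  shows "\<bar>D (n - 1) t - integral {0..t} f\<bar> \<le> U / 2"
proof -
  have "0 \<le> U" using U[OF t] by linarith
  have "0 \<le> M" using a_bound[of 1 0] n_pos x_small by force
  have "\<bar>D (n - 1) t - integral {0..t} f\<bar> \<le> (n * M * U) * t"
  proof (rule abs_deriv_le_imp_abs_le_linear[OF _ _ _ t])
    fix s assume s: "s \<in> {0..x}"
    have F: "((\<lambda>s. integral {0..s} f) has_real_derivative f s) (at s within {0..x})"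
      using s x_small f_cont by (intro integral_has_real_derivative) (auto intro: continuous_on_subset)
    have "(D (n - 1) has_real_derivative D n s) (at s within {0..x})"
      using deriv_subinterval[of "n - 1" x s] s n_pos x_small by simp
    from DERIV_diff[OF this F]
    show "((\<lambda>s. D (n - 1) s - integral {0..s} f) has_real_derivative
        - (\<Sum>i=1..n. a i s * D (n - i) s)) (at s within {0..x})"
      using f_eq[of s] s x_small by simp
    have "\<bar>a i s * D (n - i) s\<bar> \<le> M * U" if "i \<in> {1..n}" for i
      using that s x_small n_pos \<open>0 \<le> M\<close>
      by (auto simp: abs_mult intro!: mult_mono a_bound abs_le_of_last[OF _ _ U])
    then have "(\<Sum>i=1..n. \<bar>a i s * D (n - i) s\<bar>) \<le> real (card {1..n}) * (M * U)"
      by (rule sum_bounded_above)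
    from order_trans[OF sum_abs this]
    show "\<bar>- (\<Sum>i=1..n. a i s * D (n - i) s)\<bar> \<le> n * M * U"
      by (simp add: mult.assoc)
  qed (use init n_pos in simp)
  also have "\<dots> \<le> (n * M * U) * x"
    using t \<open>0 \<le> M\<close> \<open>0 \<le> U\<close> by (intro mult_left_mono) auto
  also have "\<dots> = U * (n * M * x)" by simp
  also have "\<dots> \<le> U * (1 / 2)"
    using \<open>0 \<le> U\<close> x_small by (intro mult_left_mono)
  finally show ?thesis by simp
qed

lemma
  shows last_nonneg: "0 \<le> D (n - 1) x"
    and abs_last_le_integral: "\<bar>D (n - 1) x\<bar> \<le> 2 * integral {0..x} f"
proof -
  have "continuous_on {0..x} (D (n - 1))"
    using deriv_subinterval[of "n - 1" x] n_pos x_small by (intro DERIV_continuous_on) auto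
  \<comment> \<open>The bound \<open>U\<close> is taken to be an attained maximum, so that the
    estimate at the maximiser \<open>s\<close> bounds \<open>U\<close> in terms of
    \<open>U / 2\<close>, which can then be absorbed.\<close>
  then have "\<exists>s\<in>{0..x}. \<forall>t\<in>{0..x}. \<bar>D (n - 1) t\<bar> \<le> \<bar>D (n - 1) s\<bar>"
    using x_small by (intro continuous_attains_sup continuous_on_rabs) auto
  then obtain s where s: "s \<in> {0..x}"
    and max: "\<And>t. t \<in> {0..x} \<Longrightarrow> \<bar>D (n - 1) t\<bar> \<le> \<bar>D (n - 1) s\<bar>" by blast
  have diff: "\<bar>D (n - 1) t - integral {0..t} f\<bar> \<le> \<bar>D (n - 1) s\<bar> / 2" if "t \<in> {0..x}" for t
    using max that by (rule abs_last_diff_integral_le)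
  have int: "f integrable_on {0..t}" if "t \<in> {0..x}" for t
    using that x_small
    by (intro integrable_continuous_real continuous_on_subset[OF f_cont]) auto
  have "integral {0..s} f \<le> integral {0..x} f"
    using s x_small f_nonneg int by (intro integral_subset_le) auto
  moreover have "0 \<le> integral {0..s} f"
    using s x_small f_nonneg int by (intro integral_nonneg) auto
  ultimately have "\<bar>D (n - 1) s\<bar> \<le> 2 * integral {0..x} f"
    using diff[OF s] by linarith
  moreover have x: "x \<in> {0..x}" using x_small by simp
  ultimately show "\<bar>D (n - 1) x\<bar> \<le> 2 * integral {0..x} f" "0 \<le> D (n - 1) x"
    using diff[OF x] max[OF x] by linarith+
qed

end

end

text \<open>Differentiability ensures that the value picked by \<open>vector_derivative\<close> is a
  genuine derivative.\<close>

lemma Cn_on_deriv: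
  assumes "Cn_on n S y" "k < n" "t \<in> S"
  shows "(iter_deriv_on S k y has_real_derivative iter_deriv_on S (Suc k) y t) (at t within S)"
proof -
  have "iter_deriv_on S k y differentiable (at t within S)"
    using assms by (auto simp: Cn_on_def differentiable_on_def)
  then show ?thesis
    by (simp add: vector_derivative_works iter_deriv_on_def has_real_derivative_iff_has_vector_derivative)
qed

lemma Cn_on_continuous:
  assumes "Cn_on n S y" "k \<le> n"
  shows "continuous_on S (iter_deriv_on S k y)"
  using assms by (cases "k = n") (auto simp: Cn_on_def intro: differentiable_imp_continuous_on)

text \<open>
  The derivative within the larger interval is also the one within \<open>{0..b}\<close>, which is unique; this
  covers the endpoint \<open>b\<close>, where \<open>y\<close> need not vanish on a neighbourhood.
\<close>

lemma iter_deriv_on_eq_zero: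
  assumes "Cn_on n {0..c} y" "0 < b" "b \<le> c" "\<And>t. t \<in> {0..b} \<Longrightarrow> y t = 0"
    and "k \<le> n" "t \<in> {0..b}"
  shows "iter_deriv_on {0..c} k y t = 0"
  using \<open>k \<le> n\<close> \<open>t \<in> {0..b}\<close>
proof (induction k arbitrary: t)
  case 0
  then show ?case using assms by (simp add: iter_deriv_on_def)
next
  case (Suc k)
  have "(iter_deriv_on {0..c} k y has_real_derivative iter_deriv_on {0..c} (Suc k) y t)
      (at t within {0..b})"
    using Suc.prems assms by (intro DERIV_subset[OF Cn_on_deriv[OF assms(1)]]) auto
  then have "((\<lambda>_. 0) has_vector_derivative iter_deriv_on {0..c} (Suc k) y t) (at t within {0..b})"
    unfolding has_real_derivative_iff_has_vector_derivative
    by (rule has_vector_derivative_transform[rotated 2]) (use Suc in auto)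
  then show ?case
    using vector_derivative_unique_within_closed_interval[of 0 b t "\<lambda>_. 0" _ 0] Suc.prems assms
    by (auto simp: cbox_interval)
qed

theorem theorem1p4:
  fixes n :: nat and c :: real and a :: "nat \<Rightarrow> real \<Rightarrow> real"
  assumes "n \<ge> 1" and "c > 0"
    and "\<And>i. i \<in> {1..n} \<Longrightarrow> \<exists>L. L-lipschitz_on {0..c} (a i)"
  shows "\<exists>b. 0 < b \<and> b \<le> c \<and>
    (\<forall>y :: real \<Rightarrow> real.
       Cn_on n {0..c} y \<longrightarrow>
       (\<forall>x\<in>{0..c}. lin_diff_op {0..c} n a y x \<ge> 0) \<longrightarrow>
       (\<forall>i<n. iter_deriv_on {0..c} i y 0 = 0) \<longrightarrow>
         (\<forall>i<n. \<forall>x\<in>{0..b}. iter_deriv_on {0..c} i y x \<ge> 0) \<and>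
         ((\<forall>x\<in>{0..b}. y x = 0) \<longleftrightarrow> (\<forall>x\<in>{0..b}. lin_diff_op {0..c} n a y x = 0)))"
proof -
  have a_cont: "continuous_on {0..c} (a i)" if "i \<in> {1..n}" for i
    using assms(3)[OF that] lipschitz_on_continuous_on by blast
  have "\<forall>i\<in>{1..n}. \<exists>M. \<forall>t\<in>{0..c}. \<bar>a i t\<bar> \<le> M"
    using compact_imp_bounded[OF compact_continuous_image[OF a_cont]]
    by (fastforce simp: bounded_iff)
  then obtain B where B: "\<And>i t. i \<in> {1..n} \<Longrightarrow> t \<in> {0..c} \<Longrightarrow> \<bar>a i t\<bar> \<le> B i"
    by metis
  \<comment> \<open>One bound for all coefficients; the absolute values allow each term to be
    compared with the whole sum.\<close>
  define M where "M = (\<Sum>i=1..n. \<bar>B i\<bar>)"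
  have "0 \<le> M" by (simp add: M_def sum_nonneg)
  have M: "\<bar>a i t\<bar> \<le> M" if "i \<in> {1..n}" "t \<in> {0..c}" for i t
    using B[OF that] member_le_sum[of i "{1..n}" "\<lambda>i. \<bar>B i\<bar>"] that by (force simp: M_def)
  \<comment> \<open>The bound 1 serves the descending induction, the last term gives
    \<open>n * M * b \<le> 1 / 2\<close>, and the summand 1 keeps its denominator positive when
    \<open>M = 0\<close>. The choice precedes that of \<open>y\<close>.\<close>
  define b where "b = min (min c 1) (1 / (2 * (n * M + 1)))"
  have "0 \<le> n * M" using \<open>0 \<le> M\<close> by simp
  then have b: "0 < b" "b \<le> c" "b \<le> 1"
    using \<open>0 < c\<close> by (auto simp: b_def)
  have "n * M * b \<le> n * M * (1 / (2 * (n * M + 1)))"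
    using \<open>0 \<le> n * M\<close> by (intro mult_left_mono) (auto simp: b_def)
  also have "\<dots> \<le> 1 / 2"
    using \<open>0 \<le> n * M\<close> by (simp add: divide_simps)
  finally have nMb: "n * M * b \<le> 1 / 2" .
  show ?thesis
  proof (intro exI[of _ b] conjI allI impI ballI b)
    fix y
    assume Cn: "Cn_on n {0..c} y" and nonneg: "\<forall>x\<in>{0..c}. lin_diff_op {0..c} n a y x \<ge> 0"
      and init: "\<forall>i<n. iter_deriv_on {0..c} i y 0 = 0"
    define D where "D = (\<lambda>k. iter_deriv_on {0..c} k y)"
    define f where "f = lin_diff_op {0..c} n a y"
    interpret derivative_chain D n c
      using Cn_on_deriv[OF Cn] init by unfold_locales (auto simp: D_def)
    have f_eq: "f t = D n t + (\<Sum>i=1..n. a i t * D (n - i) t)" for t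
      by (simp add: f_def lin_diff_op_def D_def)
    \<comment> \<open>Continuity of \<open>f\<close> makes its integral differentiable with
      derivative \<open>f\<close>.\<close>
    have "continuous_on {0..c} (\<lambda>t. D n t + (\<Sum>i=1..n. a i t * D (n - i) t))"
      unfolding D_def by (intro continuous_intros a_cont Cn_on_continuous[OF Cn]) auto
    then have f_cont: "continuous_on {0..c} f" by (simp add: f_eq[abs_def])
    have f_nonneg: "0 \<le> f t" if "t \<in> {0..c}" for t
      using nonneg that by (simp add: f_def)
    have n_pos: "0 < n" using \<open>n \<ge> 1\<close> by simp
    have small: "0 \<le> x" "x \<le> c" "x \<le> 1" "n * M * x \<le> 1 / 2" if "x \<in> {0..b}" for x
      using that b order_trans[OF mult_left_mono[of x b "n * M"] nMb] \<open>0 \<le> n * M\<close> by auto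
    have last: "0 \<le> D (n - 1) x" "\<bar>D (n - 1) x\<bar> \<le> 2 * integral {0..x} f" if "x \<in> {0..b}" for x
      using last_nonneg[OF M f_cont f_eq f_nonneg n_pos small[OF that]]
        abs_last_le_integral[OF M f_cont f_eq f_nonneg n_pos small[OF that]] by blast+
    show "0 \<le> iter_deriv_on {0..c} i y x" if "i < n" "x \<in> {0..b}" for i x
      using nonneg_of_last[OF b(2) last(1), of i x] that n_pos by (simp add: D_def)
    show "(\<forall>x\<in>{0..b}. y x = 0) \<longleftrightarrow> (\<forall>x\<in>{0..b}. lin_diff_op {0..c} n a y x = 0)"
    proof
      assume "\<forall>x\<in>{0..b}. y x = 0"
      then show "\<forall>x\<in>{0..b}. lin_diff_op {0..c} n a y x = 0"
        using iter_deriv_on_eq_zero[OF Cn b(1,2)] by (simp add: lin_diff_op_def)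
    next
      assume zero: "\<forall>x\<in>{0..b}. lin_diff_op {0..c} n a y x = 0"
      \<comment> \<open>With \<open>f = 0\<close> on \<open>{0..b}\<close> the integral bound forces
        \<open>D (n - 1)\<close> to vanish there; the descending bound with \<open>U = 0\<close>
        then reaches \<open>D 0\<close>, which is \<open>y\<close>.\<close>
      have "\<bar>D (n - 1) x\<bar> \<le> 0" if x: "x \<in> {0..b}" for x
      proof -
        have "integral {0..x} f = integral {0..x} (\<lambda>_. 0)"
          using zero x by (intro integral_cong) (auto simp: f_def)
        then show ?thesis using last(2)[OF x] by simp
      qed
      from abs_le_of_last[OF b(2,3) this _ n_pos, of 0]
      show "\<forall>x\<in>{0..b}. y x = 0" by (auto simp: D_def iter_deriv_on_def)
    qed
  qed
qed

end
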